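(* Let $f,g,\phi$ satisfy assumption (A), let $N_1,N_2,Q$, $M$ and $P$ satisfy assumption (B), assume $\mu>\gamma+\frac{L}{4}$, and assume that $P$ is monotone (all as in the context). Let $\theta\in(0,2)$ and let $t$ satisfy $\frac{\mu-\gamma-\frac{L}{4}}{L+q}\le t\le\frac{\frac34L+q}{\mu-\gamma}$. Let $\{u_k\}_{k\in\mathbb{N}}$, $\{r_k\}_{k\in\mathbb{N}}$ be generated from $u_0\in\mathcal{H}\times\mathcal{H}$ by Algorithm 1 with constant parameters, i.e. $r_k=(M+P)^{-1}Mu_k$ and $u_{k+1}=u_k-\theta t\,C(u_k-r_k)$. Assume the condition $\mu>\gamma+L$, $2\mu>\theta t(L+q)q$, under which $D$ and $G$ are positive definite. Let $u^*\in\operatorname{zer}P$. Then for any positive integer $n$, $$\|N(u_{n+1}-r_{n+1})\|_H^2<\|N(u_n-r_n)\|_H^2$$ and $$\|N(u_n-r_n)\|_H^2\le\frac{1}{(n+1)c}\|u_0-u^*\|_H^2,$$ where $c>0$ is a constant independent of $n$.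
   Context: $\mathcal{H}$ is a real Hilbert space; $u=(x,y)\in\mathcal{H}\times\mathcal{H}$. Assumption (A): $f,g:\mathcal{H}\to(-\infty,+\infty]$ are proper, lower semicontinuous and convex; $\phi:\mathcal{H}\times\mathcal{H}\to\mathbb{R}$ is continuously differentiable with Lipschitz continuous gradient; $\phi(\cdot,y)$ is $L_{xx}$-weakly convex for each fixed $y$ and $-\phi(x,\cdot)$ is $L_{yy}$-weakly convex for each fixed $x$ ($h$ is $\rho$-weakly convex if $h+\frac{\rho}{2}\|\cdot\|^2$ is convex). The Lipschitz constants of the partial gradients are: $\nabla_x\phi$ is $L_{xx}$-Lipschitz in $x$ and $L_{xy}$-Lipschitz in $y$; $\nabla_y\phi$ is $L_{yx}$-Lipschitz in $x$ and $L_{yy}$-Lipschitz in $y$. Put $L=\sqrt{L_{xx}^2+L_{yx}^2+L_{xy}^2+L_{yy}^2}$ and $\gamma=\max\{L_{xx},L_{yy}\}$. Operators on $\mathcal{H}\times\mathcal{H}$: $A(x,y)=\partial f(x)\times\partial g(y)$, $B(x,y)=(\nabla_x\phi(x,y),-\nabla_y\phi(x,y))$, $P=A+B$ (set-valued), and $M(x,y)=(N_1x-\nabla_x\phi(x,y),\;Qx+N_2y+\nabla_y\phi(x,y))$ for operators $N_1,N_2,Q:\mathcal{H}\to\mathcal{H}$. $\operatorname{zer}P=\{u:0\in Pu\}$ is assumed nonempty. In the monotone setting, monotonicity is realized by taking $\phi$ convex-concave, so that $B$ is monotone as well. Assumption (B): $N_i$ is $\mu_i$-strongly monotone and $L_i$-Lipschitz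 continuous ($i=1,2$); $N_1,N_2,Q$ are single-valued and self-adjoint (an operator $T$ is self-adjoint if $\langle Tu,v\rangle=\langle u,Tv\rangle$ for all $u,v$); $N_1,N_2$ are invertible; $M+P$ is maximally monotone. Put $\mu=\min\{\mu_1,\mu_2\}-L-\frac{\|Q\|}{2}$, assumed positive, and $q=\gamma+\max\{L_1,L_2\}+\frac{\|Q\|}{2}$; $M$ is taken to be $\mu$-strongly monotone and $q$-Lipschitz. Further operators: $C=M+B$, i.e. $C(x,y)=(N_1x,\,Qx+N_2y)$; $D=I-BC^{-1}$, so that $M=DC$; $H=\frac{1}{\theta t}D$; $N=\theta tC$, so that $M=HN$; $G=M+M^T-N^THN$, where $^T$ denotes the adjoint. "Positive definite" means self-adjoint (hence linear) and $\langle w,Sw\rangle\ge\alpha\|w\|^2$ for some $\alpha>0$ and all $w$. For an operator $S$, $\|w\|_S^2=\langle w,Sw\rangle$. The positive definiteness of $D$ and $G$ is part of the hypotheses of the claim (positive definiteness of $D$ makes $D$, and hence $M=DC$, linear, so that $M^T$ makes sense).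
   Formalization: The strict decrease is proved only for n with u_{n+1}-r_{n+1} ≠ u_n-r_n; otherwise both sides are equal, and this can occur (f=|·|, g=φ=0, N_1=N_2=I, Q=0, θ=t=1, u_0=(3,0), n=1). *)

theory Defs
  imports "HOL-Analysis.Analysis"
begin

definition proper :: "('a \<Rightarrow> ereal) \<Rightarrow> bool" where
  "proper f \<longleftrightarrow> (\<forall>x. f x \<noteq> -\<infinity>) \<and> (\<exists>x. f x \<noteq> \<infinity>)"

definition lower_semicontinuous :: "('a::topological_space \<Rightarrow> ereal) \<Rightarrow> bool" where
  "lower_semicontinuous f \<longleftrightarrow> (\<forall>x. f x \<le> Liminf (at x) f)"

text \<open>Only used for functions that never take the value \<open>-\<infinity>\<close>, so the right-hand side
  is never of the form \<open>\<infinity> - \<infinity>\<close>.\<close>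

definition ereal_convex :: "('a::real_vector \<Rightarrow> ereal) \<Rightarrow> bool" where
  "ereal_convex f \<longleftrightarrow>
     (\<forall>x y. \<forall>s::real. 0 < s \<and> s < 1 \<longrightarrow>
        f (s *\<^sub>R x + (1 - s) *\<^sub>R y) \<le> ereal s * f x + ereal (1 - s) * f y)"

text \<open>For proper \<open>f\<close> this is empty at points where \<open>f\<close> is \<open>\<infinity>\<close>.\<close>

definition subdiff :: "('a::real_inner \<Rightarrow> ereal) \<Rightarrow> 'a \<Rightarrow> 'a set" where
  "subdiff f x = {v. \<forall>y. f x + ereal (v \<bullet> (y - x)) \<le> f y}"

definition weakly_convex :: "real \<Rightarrow> ('a::real_inner \<Rightarrow> real) \<Rightarrow> bool" where
  "weakly_convex \<rho> h \<longleftrightarrow> convex_on UNIV (\<lambda>x. h x + \<rho> / 2 * (norm x)\<^sup>2)"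

definition gradient :: "('a::real_inner \<Rightarrow> real) \<Rightarrow> 'a \<Rightarrow> 'a" where
  "gradient h x = (THE D. GDERIV h x :> D)"

definition grad_x :: "('a::real_inner \<times> 'a \<Rightarrow> real) \<Rightarrow> 'a \<times> 'a \<Rightarrow> 'a" where
  "grad_x \<phi> u = gradient (\<lambda>x. \<phi> (x, snd u)) (fst u)"

definition grad_y :: "('a::real_inner \<times> 'a \<Rightarrow> real) \<Rightarrow> 'a \<times> 'a \<Rightarrow> 'a" where
  "grad_y \<phi> u = gradient (\<lambda>y. \<phi> (fst u, y)) (snd u)"

definition strongly_monotone :: "real \<Rightarrow> ('a::real_inner \<Rightarrow> 'a) \<Rightarrow> bool" where
  "strongly_monotone m T \<longleftrightarrow> (\<forall>u v. (T u - T v) \<bullet> (u - v) \<ge> m * (norm (u - v))\<^sup>2)"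

text \<open>Self-adjointness of an everywhere defined map entails linearity.\<close>

definition self_adjoint :: "('a::real_inner \<Rightarrow> 'a) \<Rightarrow> bool" where
  "self_adjoint T \<longleftrightarrow> (\<forall>u v. T u \<bullet> v = u \<bullet> T v)"

definition pos_definite :: "('a::real_inner \<Rightarrow> 'a) \<Rightarrow> bool" where
  "pos_definite S \<longleftrightarrow> self_adjoint S \<and> (\<exists>\<alpha>>0. \<forall>w. w \<bullet> S w \<ge> \<alpha> * (norm w)\<^sup>2)"

definition sqnorm :: "('a::real_inner \<Rightarrow> 'a) \<Rightarrow> 'a \<Rightarrow> real" where
  "sqnorm S w = w \<bullet> S w"

definition set_monotone :: "('a::real_inner \<Rightarrow> 'a set) \<Rightarrow> bool" where
  "set_monotone T \<longleftrightarrow> (\<forall>u v. \<forall>a\<in>T u. \<forall>b\<in>T v. (a - b) \<bullet> (u - v) \<ge> 0)"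

definition maximally_monotone :: "('a::real_inner \<Rightarrow> 'a set) \<Rightarrow> bool" where
  "maximally_monotone T \<longleftrightarrow>
     set_monotone T \<and> (\<forall>S. set_monotone S \<and> (\<forall>u. T u \<subseteq> S u) \<longrightarrow> S = T)"

definition op_sum :: "('a::plus \<Rightarrow> 'a) \<Rightarrow> ('a \<Rightarrow> 'a set) \<Rightarrow> 'a \<Rightarrow> 'a set" where
  "op_sum S T u = {S u + p | p. p \<in> T u}"

definition set_inverse :: "('a \<Rightarrow> 'a set) \<Rightarrow> 'a \<Rightarrow> 'a set" where
  "set_inverse T v = {u. v \<in> T u}"

definition zer :: "('a::zero \<Rightarrow> 'a set) \<Rightarrow> 'a set" where
  "zer T = {u. 0 \<in> T u}"

definition opA :: "('a::real_inner \<Rightarrow> ereal) \<Rightarrow> ('a \<Rightarrow> ereal) \<Rightarrow> 'a \<times> 'a \<Rightarrow> ('a \<times> 'a) set" where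
  "opA f g u = subdiff f (fst u) \<times> subdiff g (snd u)"

definition opB :: "('a::real_inner \<times> 'a \<Rightarrow> real) \<Rightarrow> 'a \<times> 'a \<Rightarrow> 'a \<times> 'a" where
  "opB \<phi> u = (grad_x \<phi> u, - grad_y \<phi> u)"

definition opP :: "('a::real_inner \<Rightarrow> ereal) \<Rightarrow> ('a \<Rightarrow> ereal) \<Rightarrow> ('a \<times> 'a \<Rightarrow> real)
    \<Rightarrow> 'a \<times> 'a \<Rightarrow> ('a \<times> 'a) set" where
  "opP f g \<phi> = op_sum (opB \<phi>) (opA f g)"

definition opM :: "('a::real_inner \<times> 'a \<Rightarrow> real) \<Rightarrow> ('a \<Rightarrow> 'a) \<Rightarrow> ('a \<Rightarrow> 'a) \<Rightarrow> ('a \<Rightarrow> 'a)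
    \<Rightarrow> 'a \<times> 'a \<Rightarrow> 'a \<times> 'a" where
  "opM \<phi> N1 N2 Q u =
     (N1 (fst u) - grad_x \<phi> u, Q (fst u) + N2 (snd u) + grad_y \<phi> u)"

definition opC :: "('a::real_inner \<times> 'a \<Rightarrow> real) \<Rightarrow> ('a \<Rightarrow> 'a) \<Rightarrow> ('a \<Rightarrow> 'a) \<Rightarrow> ('a \<Rightarrow> 'a)
    \<Rightarrow> 'a \<times> 'a \<Rightarrow> 'a \<times> 'a" where
  "opC \<phi> N1 N2 Q u = opM \<phi> N1 N2 Q u + opB \<phi> u"

lemma opC_eq: "opC \<phi> N1 N2 Q (x, y) = (N1 x, Q x + N2 y)"
  by (simp add: opC_def opM_def opB_def)

lemma bij_opC:
  assumes N1: "bij N1" and N2: "bij N2"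
  shows "bij (opC \<phi> N1 N2 Q)"
proof (rule bijI)
  show "inj (opC \<phi> N1 N2 Q)"
  proof (rule injI)
    fix u v assume "opC \<phi> N1 N2 Q u = opC \<phi> N1 N2 Q v"
    then have e: "N1 (fst u) = N1 (fst v)" "Q (fst u) + N2 (snd u) = Q (fst v) + N2 (snd v)"
      by (metis opC_eq prod.collapse prod.inject)+
    have x: "fst u = fst v" using injD[OF bij_is_inj[OF N1] e(1)] .
    with e(2) have "N2 (snd u) = N2 (snd v)" by simp
    from injD[OF bij_is_inj[OF N2] this] x show "u = v" by (rule prod_eqI[rotated])
  qed
  show "surj (opC \<phi> N1 N2 Q)"
  proof (rule surjI)
    fix v :: "'a \<times> 'a"
    have "N1 (inv N1 (fst v)) = fst v" "N2 (inv N2 w) = w" for w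
      using N1 N2 by (simp_all add: bij_is_surj surj_f_inv_f)
    then show "opC \<phi> N1 N2 Q (inv N1 (fst v), inv N2 (snd v - Q (inv N1 (fst v)))) = v"
      by (simp add: opC_eq)
  qed
qed

definition opD :: "('a::real_inner \<times> 'a \<Rightarrow> real) \<Rightarrow> ('a \<Rightarrow> 'a) \<Rightarrow> ('a \<Rightarrow> 'a) \<Rightarrow> ('a \<Rightarrow> 'a)
    \<Rightarrow> 'a \<times> 'a \<Rightarrow> 'a \<times> 'a" where
  "opD \<phi> N1 N2 Q u = u - opB \<phi> (inv (opC \<phi> N1 N2 Q) u)"

definition opH :: "real \<Rightarrow> real \<Rightarrow> ('a::real_inner \<times> 'a \<Rightarrow> real) \<Rightarrow> ('a \<Rightarrow> 'a) \<Rightarrow> ('a \<Rightarrow> 'a)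
    \<Rightarrow> ('a \<Rightarrow> 'a) \<Rightarrow> 'a \<times> 'a \<Rightarrow> 'a \<times> 'a" where
  "opH \<theta> t \<phi> N1 N2 Q u = (1 / (\<theta> * t)) *\<^sub>R opD \<phi> N1 N2 Q u"

definition opN :: "real \<Rightarrow> real \<Rightarrow> ('a::real_inner \<times> 'a \<Rightarrow> real) \<Rightarrow> ('a \<Rightarrow> 'a) \<Rightarrow> ('a \<Rightarrow> 'a)
    \<Rightarrow> ('a \<Rightarrow> 'a) \<Rightarrow> 'a \<times> 'a \<Rightarrow> 'a \<times> 'a" where
  "opN \<theta> t \<phi> N1 N2 Q u = (\<theta> * t) *\<^sub>R opC \<phi> N1 N2 Q u"

definition opG :: "real \<Rightarrow> real \<Rightarrow> ('a::real_inner \<times> 'a \<Rightarrow> real) \<Rightarrow> ('a \<Rightarrow> 'a) \<Rightarrow> ('a \<Rightarrow> 'a)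
    \<Rightarrow> ('a \<Rightarrow> 'a) \<Rightarrow> 'a \<times> 'a \<Rightarrow> 'a \<times> 'a" where
  "opG \<theta> t \<phi> N1 N2 Q u =
     opM \<phi> N1 N2 Q u + adjoint (opM \<phi> N1 N2 Q) u
     - adjoint (opN \<theta> t \<phi> N1 N2 Q) (opH \<theta> t \<phi> N1 N2 Q (opN \<theta> t \<phi> N1 N2 Q u))"

definition const_L :: "real \<Rightarrow> real \<Rightarrow> real \<Rightarrow> real \<Rightarrow> real" where
  "const_L Lxx Lxy Lyx Lyy = sqrt (Lxx\<^sup>2 + Lyx\<^sup>2 + Lxy\<^sup>2 + Lyy\<^sup>2)"

text \<open>By the Hellinger--Toeplitz theorem a self-adjoint \<open>Q\<close> on a Hilbert space is bounded, so
  \<open>onorm Q\<close> is its operator norm.\<close>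

definition const_mu :: "real \<Rightarrow> real \<Rightarrow> real \<Rightarrow> ('a::real_inner \<Rightarrow> 'a) \<Rightarrow> real" where
  "const_mu L \<mu>1 \<mu>2 Q = min \<mu>1 \<mu>2 - L - onorm Q / 2"

definition const_q :: "real \<Rightarrow> real \<Rightarrow> real \<Rightarrow> ('a::real_inner \<Rightarrow> 'a) \<Rightarrow> real" where
  "const_q \<gamma> L1 L2 Q = \<gamma> + max L1 L2 + onorm Q / 2"

definition assumption_A :: "('a::{real_inner, complete_space} \<Rightarrow> ereal) \<Rightarrow> ('a \<Rightarrow> ereal)
    \<Rightarrow> ('a \<times> 'a \<Rightarrow> real) \<Rightarrow> real \<Rightarrow> real \<Rightarrow> real \<Rightarrow> real \<Rightarrow> bool" where
  "assumption_A f g \<phi> Lxx Lxy Lyx Lyy \<longleftrightarrow>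
     proper f \<and> lower_semicontinuous f \<and> ereal_convex f \<and>
     proper g \<and> lower_semicontinuous g \<and> ereal_convex g \<and>
     (\<forall>u. GDERIV \<phi> u :> gradient \<phi> u) \<and>
     continuous_on UNIV (gradient \<phi>) \<and>
     (\<exists>K. K-lipschitz_on UNIV (gradient \<phi>)) \<and>
     (\<forall>y. weakly_convex Lxx (\<lambda>x. \<phi> (x, y))) \<and>
     (\<forall>x. weakly_convex Lyy (\<lambda>y. - \<phi> (x, y))) \<and>
     (\<forall>y. Lxx-lipschitz_on UNIV (\<lambda>x. grad_x \<phi> (x, y))) \<and>
     (\<forall>x. Lxy-lipschitz_on UNIV (\<lambda>y. grad_x \<phi> (x, y))) \<and>
     (\<forall>y. Lyx-lipschitz_on UNIV (\<lambda>x. grad_y \<phi> (x, y))) \<and>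
     (\<forall>x. Lyy-lipschitz_on UNIV (\<lambda>y. grad_y \<phi> (x, y)))"

definition assumption_B :: "('a::{real_inner, complete_space} \<Rightarrow> ereal) \<Rightarrow> ('a \<Rightarrow> ereal)
    \<Rightarrow> ('a \<times> 'a \<Rightarrow> real) \<Rightarrow> ('a \<Rightarrow> 'a) \<Rightarrow> ('a \<Rightarrow> 'a) \<Rightarrow> ('a \<Rightarrow> 'a)
    \<Rightarrow> real \<Rightarrow> real \<Rightarrow> real \<Rightarrow> real \<Rightarrow> real \<Rightarrow> real \<Rightarrow> bool" where
  "assumption_B f g \<phi> N1 N2 Q \<mu>1 \<mu>2 L1 L2 \<mu> q \<longleftrightarrow>
     0 < \<mu>1 \<and> strongly_monotone \<mu>1 N1 \<and> L1-lipschitz_on UNIV N1 \<and>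
     0 < \<mu>2 \<and> strongly_monotone \<mu>2 N2 \<and> L2-lipschitz_on UNIV N2 \<and>
     self_adjoint N1 \<and> self_adjoint N2 \<and> self_adjoint Q \<and>
     bij N1 \<and> bij N2 \<and>
     maximally_monotone (op_sum (opM \<phi> N1 N2 Q) (opP f g \<phi>)) \<and>
     0 < \<mu> \<and> strongly_monotone \<mu> (opM \<phi> N1 N2 Q) \<and>
     q-lipschitz_on UNIV (opM \<phi> N1 N2 Q)"

definition algorithm1 :: "('a::{real_inner, complete_space} \<Rightarrow> ereal) \<Rightarrow> ('a \<Rightarrow> ereal)
    \<Rightarrow> ('a \<times> 'a \<Rightarrow> real) \<Rightarrow> ('a \<Rightarrow> 'a) \<Rightarrow> ('a \<Rightarrow> 'a) \<Rightarrow> ('a \<Rightarrow> 'a) \<Rightarrow> real \<Rightarrow> real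
    \<Rightarrow> (nat \<Rightarrow> 'a \<times> 'a) \<Rightarrow> (nat \<Rightarrow> 'a \<times> 'a) \<Rightarrow> bool" where
  "algorithm1 f g \<phi> N1 N2 Q \<theta> t u r \<longleftrightarrow>
     (\<forall>k. set_inverse (op_sum (opM \<phi> N1 N2 Q) (opP f g \<phi>)) (opM \<phi> N1 N2 Q (u k)) = {r k} \<and>
          u (Suc k) = u k - (\<theta> * t) *\<^sub>R opC \<phi> N1 N2 Q (u k - r k))"

end

theory Submission
  imports Defs
begin

text \<open>
  The algorithm is a preconditioned fixed-point iteration. Write \<open>w\<^sub>k = u\<^sub>k - r\<^sub>k\<close>. The resolvent step
  says \<open>M u\<^sub>k - M r\<^sub>k \<in> P r\<^sub>k\<close>, and \<open>M\<close> is linear: a self-adjoint map is linear, hence so are \<open>D\<close>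
  and \<open>C\<close>, whose blocks are self-adjoint, and \<open>M = D C\<close>. Hence \<open>M w\<^sub>k \<in> P r\<^sub>k\<close>, while the update step reads
  \<open>u\<^sub>k\<^sub>+\<^sub>1 = u\<^sub>k - N w\<^sub>k\<close> with \<open>M = H N\<close>.

  Both claims come from expanding a square in the form \<open>H\<close> and using monotonicity of \<open>P\<close>
  on the cross term. The cross terms contain \<open>H N = M\<close>, so what is left over is always
  \<open>2\<langle>w, M w\<rangle> - \<parallel>N w\<parallel>\<^sub>H\<^sup>2 = \<parallel>w\<parallel>\<^sub>G\<^sup>2\<close> (\<open>sqnorm_opG\<close>).
  Monotonicity between \<open>r\<^sub>k\<close> and a zero \<open>u\<^sup>*\<close> of \<open>P\<close> gives
  \<open>\<parallel>u\<^sub>k\<^sub>+\<^sub>1 - u\<^sup>*\<parallel>\<^sub>H\<^sup>2 \<le> \<parallel>u\<^sub>k - u\<^sup>*\<parallel>\<^sub>H\<^sup>2 - \<parallel>w\<^sub>k\<parallel>\<^sub>G\<^sup>2\<close> (\<open>fejer_step\<close>), and monotonicity between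
  \<open>r\<^sub>k\<close> and \<open>r\<^sub>k\<^sub>+\<^sub>1\<close> gives \<open>\<parallel>N w\<^sub>k\<^sub>+\<^sub>1\<parallel>\<^sub>H\<^sup>2 \<le> \<parallel>N w\<^sub>k\<parallel>\<^sub>H\<^sup>2 - \<parallel>w\<^sub>k\<^sub>+\<^sub>1 - w\<^sub>k\<parallel>\<^sub>G\<^sup>2\<close> (\<open>residual_step\<close>).
  As \<open>G\<close> is positive definite, the second inequality is strict decrease whenever
  \<open>w\<^sub>k\<^sub>+\<^sub>1 \<noteq> w\<^sub>k\<close>. Positive definiteness
  of \<open>G\<close> together with the Lipschitz bound on \<open>M\<close> also yields \<open>c \<parallel>N w\<parallel>\<^sub>H\<^sup>2 \<le> \<parallel>w\<parallel>\<^sub>G\<^sup>2\<close> for some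
  \<open>c > 0\<close>. Summing the first inequality over \<open>k \<le> n\<close> then bounds \<open>c\<close> times the sum of
  \<open>n + 1\<close> squared residuals, of which the last is the smallest; this is the \<open>1/(n+1)\<close> rate.
\<close>

section \<open>Self-adjoint maps\<close>

lemma self_adjoint_linear:
  fixes T :: "'b::real_inner \<Rightarrow> 'b"
  assumes "self_adjoint T"
  shows "linear T"
proof (rule linearI)
  have T: "T u \<bullet> v = u \<bullet> T v" for u v
    using assms by (simp add: self_adjoint_def)
  show "T (x + y) = T x + T y" for x y
  proof -
    have "T (x + y) \<bullet> v = (T x + T y) \<bullet> v" for v
      by (simp add: T inner_add_left)
    then show ?thesis by (metis vector_eq_rdot)
  qed
  show "T (a *\<^sub>R x) = a *\<^sub>R T x" for a x
  proof -
    have "T (a *\<^sub>R x) \<bullet> v = (a *\<^sub>R T x) \<bullet> v" for v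
      by (simp add: T)
    then show ?thesis by (metis vector_eq_rdot)
  qed
qed

lemma sqnorm_add:
  fixes S :: "'b::real_inner \<Rightarrow> 'b"
  assumes "self_adjoint S"
  shows "sqnorm S (a + b) = sqnorm S a + 2 * (a \<bullet> S b) + sqnorm S b"
proof -
  have "b \<bullet> S a = a \<bullet> S b"
    using assms by (metis self_adjoint_def inner_commute)
  then show ?thesis
    by (simp add: sqnorm_def linear_add[OF self_adjoint_linear[OF assms]] inner_add_left inner_add_right)
qed

lemma sqnorm_diff:
  fixes S :: "'b::real_inner \<Rightarrow> 'b"
  assumes "self_adjoint S"
  shows "sqnorm S (a - b) = sqnorm S a - 2 * (a \<bullet> S b) + sqnorm S b"
  using sqnorm_add[OF assms, of a "- b"]
  by (simp add: sqnorm_def linear_neg[OF self_adjoint_linear[OF assms]])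

section \<open>The relaxed resolvent iteration in an inner product space\<close>

text \<open>Monotonicity between \<open>r\<close> and the zero \<open>z\<close> gives \<open>\<langle>r - z, H N (v - r)\<rangle> \<ge> 0\<close>, which is
  the amount by which \<open>\<langle>v - z, H N (v - r)\<rangle>\<close>, the cross term of the expanded square, exceeds
  \<open>\<langle>v - r, H N (v - r)\<rangle>\<close>.\<close>

lemma fejer_step:
  fixes H N :: "'b::real_inner \<Rightarrow> 'b"
  assumes P: "set_monotone P" and H: "self_adjoint H"
    and r: "H (N (v - r)) \<in> P r" and z: "0 \<in> P z"
  shows "sqnorm H (v - N (v - r) - z)
    \<le> sqnorm H (v - z) - (2 * ((v - r) \<bullet> H (N (v - r))) - sqnorm H (N (v - r)))"
proof -
  define m where "m = H (N (v - r))"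
  have "(m - 0) \<bullet> (r - z) \<ge> 0"
    using P r z unfolding set_monotone_def m_def by blast
  then have "(r - z) \<bullet> m \<ge> 0"
    by (simp add: inner_commute)
  moreover have "(v - z) \<bullet> m = (v - r) \<bullet> m + (r - z) \<bullet> m"
    by (simp add: inner_diff_left)
  ultimately have "sqnorm H ((v - z) - N (v - r))
      \<le> sqnorm H (v - z) - (2 * ((v - r) \<bullet> m) - sqnorm H (N (v - r)))"
    by (simp add: sqnorm_diff[OF H] m_def)
  then show ?thesis
    by (simp only: m_def diff_diff_eq add.commute)
qed

text \<open>The resolvent points satisfy \<open>r' - r = -(N w + (w' - w))\<close> for consecutive residuals \<open>w\<close> and
  \<open>w'\<close>, so monotonicity between them controls the cross term of \<open>N w\<close> and \<open>N (w' - w)\<close>.\<close>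

lemma residual_step:
  fixes H N :: "'b::real_inner \<Rightarrow> 'b"
  assumes P: "set_monotone P" and H: "self_adjoint H" and N: "linear N"
    and r: "H (N (v - r)) \<in> P r" and r': "H (N (v' - r')) \<in> P r'"
    and v': "v' = v - N (v - r)"
    and d: "d = (v' - r') - (v - r)"
  shows "sqnorm H (N (v' - r')) \<le> sqnorm H (N (v - r)) - (2 * (d \<bullet> H (N d)) - sqnorm H (N d))"
proof -
  have "H (N (v' - r')) - H (N (v - r)) = H (N d)"
    by (simp add: d linear_diff[OF N] linear_diff[OF self_adjoint_linear[OF H]])
  moreover have "(H (N (v' - r')) - H (N (v - r))) \<bullet> (r' - r) \<ge> 0"
    using P r r' unfolding set_monotone_def by blast
  moreover have "r' - r = - (N (v - r) + d)"
    by (simp add: d v')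
  ultimately have "H (N d) \<bullet> (N (v - r) + d) \<le> 0"
    by (simp add: inner_diff_right inner_add_right)
  then have cross: "N (v - r) \<bullet> H (N d) + d \<bullet> H (N d) \<le> 0"
    by (simp add: inner_add_right inner_commute)
  have "v' - r' = (v - r) + d" by (simp add: d)
  then have "N (v' - r') = N (v - r) + N d"
    using linear_add[OF N] by metis
  then show ?thesis
    using cross by (simp add: sqnorm_add[OF H])
qed

text \<open>Telescoping the decrease of \<open>e\<close> leaves \<open>c\<close> times a sum of \<open>n + 1\<close> terms, each at least
  the last.\<close>

lemma decseq_rate:
  fixes a e :: "nat \<Rightarrow> real"
  assumes c: "c > 0" and a: "\<And>k. a (Suc k) \<le> a k"
    and e: "\<And>k. e (Suc k) \<le> e k - c * a k" and e0: "\<And>k. e k \<ge> 0"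
  shows "a n \<le> 1 / (real (n + 1) * c) * e 0"
proof -
  have "real k * (c * a n) + e k \<le> e 0" if "k \<le> Suc n" for k
    using that
  proof (induction k)
    case (Suc k)
    have "a n \<le> a k"
      using Suc.prems lift_Suc_antimono_le[of a, OF a, of k n] by simp
    then have "c * a n \<le> c * a k" using c by simp
    then show ?case
      using Suc e[of k] by (simp add: algebra_simps)
  qed simp
  from this[of "Suc n"] e0[of "Suc n"] have "real (n + 1) * c * a n \<le> e 0"
    by (simp add: mult.assoc)
  moreover have "real (n + 1) * c > 0" using c by simp
  ultimately show ?thesis
    by (simp add: pos_le_divide_eq mult.commute)
qed

section \<open>The operators of the algorithm\<close>

lemma opD_opC:
  assumes "bij N1" "bij N2"
  shows "opD \<phi> N1 N2 Q (opC \<phi> N1 N2 Q w) = opM \<phi> N1 N2 Q w"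
proof -
  have "opD \<phi> N1 N2 Q (opC \<phi> N1 N2 Q w) = opC \<phi> N1 N2 Q w - opB \<phi> w"
    using inv_f_f[OF bij_is_inj[OF bij_opC[OF assms]]] by (simp add: opD_def)
  then show ?thesis by (simp add: opC_def)
qed

lemma opH_opN:
  assumes "bij N1" "bij N2" "self_adjoint (opD \<phi> N1 N2 Q)" "\<theta> * t \<noteq> 0"
  shows "opH \<theta> t \<phi> N1 N2 Q (opN \<theta> t \<phi> N1 N2 Q w) = opM \<phi> N1 N2 Q w"
  using assms(4) linear_cmul[OF self_adjoint_linear[OF assms(3)]]
  by (simp add: opH_def opN_def opD_opC[OF assms(1,2)])

lemma self_adjoint_opH:
  assumes "self_adjoint (opD \<phi> N1 N2 Q)"
  shows "self_adjoint (opH \<theta> t \<phi> N1 N2 Q)"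
  using assms by (simp add: self_adjoint_def opH_def)

lemma linear_opC:
  assumes "linear N1" "linear N2" "linear Q"
  shows "linear (opC \<phi> N1 N2 Q)"
proof (rule linearI)
  fix u v :: "'a \<times> 'a" and s :: real
  show "opC \<phi> N1 N2 Q (u + v) = opC \<phi> N1 N2 Q u + opC \<phi> N1 N2 Q v"
    by (cases u; cases v) (simp add: opC_eq assms[THEN linear_add])
  show "opC \<phi> N1 N2 Q (s *\<^sub>R u) = s *\<^sub>R opC \<phi> N1 N2 Q u"
    by (cases u) (simp add: opC_eq assms[THEN linear_cmul] scaleR_add_right)
qed

text \<open>Adjoints of bounded operators come in general from the Riesz representation theorem. Here
  the block form of \<open>C\<close> provides one explicitly, and then \<open>C\<^sup>T D\<close> and \<open>\<theta> t C\<^sup>T\<close> are adjoints of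
  \<open>M\<close> and \<open>N\<close>.\<close>

lemma opC_adjoint_exists:
  assumes "self_adjoint N1" "self_adjoint N2" "self_adjoint Q"
  obtains C' where "\<And>u v. opC \<phi> N1 N2 Q u \<bullet> v = u \<bullet> C' v"
proof
  show "opC \<phi> N1 N2 Q u \<bullet> v = u \<bullet> (N1 (fst v) + Q (snd v), N2 (snd v))" for u v
    using assms
    by (cases u; cases v)
      (simp add: opC_eq inner_add_left inner_add_right self_adjoint_def)
qed

lemma inner_adjoint:
  fixes T T' :: "'b::real_inner \<Rightarrow> 'b"
  assumes "\<And>u v. T u \<bullet> v = u \<bullet> T' v"
  shows "u \<bullet> adjoint T v = T u \<bullet> v"
  using adjoint_unique[of T T'] assms by simp

lemma sqnorm_opG:
  assumes N: "self_adjoint N1" "self_adjoint N2" "self_adjoint Q" "bij N1" "bij N2"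
    and D: "self_adjoint (opD \<phi> N1 N2 Q)"
  shows "sqnorm (opG \<theta> t \<phi> N1 N2 Q) w
    = 2 * (w \<bullet> opM \<phi> N1 N2 Q w) - sqnorm (opH \<theta> t \<phi> N1 N2 Q) (opN \<theta> t \<phi> N1 N2 Q w)"
proof -
  obtain C' where C': "\<And>u v. opC \<phi> N1 N2 Q u \<bullet> v = u \<bullet> C' v"
    using opC_adjoint_exists[OF N(1-3)] by blast
  have "opM \<phi> N1 N2 Q u \<bullet> v = u \<bullet> C' (opD \<phi> N1 N2 Q v)" for u v
    using D C' by (metis opD_opC[OF N(4,5)] self_adjoint_def)
  then have M: "u \<bullet> adjoint (opM \<phi> N1 N2 Q) v = opM \<phi> N1 N2 Q u \<bullet> v" for u v
    by (rule inner_adjoint)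
  have "opN \<theta> t \<phi> N1 N2 Q u \<bullet> v = u \<bullet> ((\<theta> * t) *\<^sub>R C' v)" for u v
    by (simp add: opN_def C')
  then have "u \<bullet> adjoint (opN \<theta> t \<phi> N1 N2 Q) v = opN \<theta> t \<phi> N1 N2 Q u \<bullet> v" for u v
    by (rule inner_adjoint)
  with M show ?thesis
    by (simp add: sqnorm_def opG_def inner_add_right inner_diff_right inner_commute)
qed

section \<open>Convergence rate of the algorithm\<close>

theorem theorem5p3:
  fixes f g :: "'a::{real_inner, complete_space} \<Rightarrow> ereal"
    and \<phi> :: "'a \<times> 'a \<Rightarrow> real"
    and N1 N2 Q :: "'a \<Rightarrow> 'a"
    and Lxx Lxy Lyx Lyy \<mu>1 \<mu>2 L1 L2 L \<gamma> \<mu> q \<theta> t :: real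
  assumes L: "L = const_L Lxx Lxy Lyx Lyy"
    and \<gamma>: "\<gamma> = max Lxx Lyy"
    and \<mu>: "\<mu> = const_mu L \<mu>1 \<mu>2 Q"
    and q: "q = const_q \<gamma> L1 L2 Q"
    and A: "assumption_A f g \<phi> Lxx Lxy Lyx Lyy"
    and B: "assumption_B f g \<phi> N1 N2 Q \<mu>1 \<mu>2 L1 L2 \<mu> q"
    and zer: "zer (opP f g \<phi>) \<noteq> {}"
    and mono: "set_monotone (opP f g \<phi>)"
    and \<mu>_quarter: "\<mu> > \<gamma> + L / 4"
    and \<theta>: "0 < \<theta>" "\<theta> < 2"
    and t: "(\<mu> - \<gamma> - L / 4) / (L + q) \<le> t" "t \<le> (3 / 4 * L + q) / (\<mu> - \<gamma>)"
    and cond: "\<mu> > \<gamma> + L" "2 * \<mu> > \<theta> * t * (L + q) * q"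
    and D: "pos_definite (opD \<phi> N1 N2 Q)"
    and G: "pos_definite (opG \<theta> t \<phi> N1 N2 Q)"
  shows "\<exists>c>0. \<forall>u r us.
      algorithm1 f g \<phi> N1 N2 Q \<theta> t u r \<and> us \<in> zer (opP f g \<phi>) \<longrightarrow>
      (\<forall>n\<ge>1.
        (u (n + 1) - r (n + 1) \<noteq> u n - r n \<longrightarrow>
          sqnorm (opH \<theta> t \<phi> N1 N2 Q) (opN \<theta> t \<phi> N1 N2 Q (u (n + 1) - r (n + 1)))
            < sqnorm (opH \<theta> t \<phi> N1 N2 Q) (opN \<theta> t \<phi> N1 N2 Q (u n - r n))) \<and>
        sqnorm (opH \<theta> t \<phi> N1 N2 Q) (opN \<theta> t \<phi> N1 N2 Q (u n - r n))
          \<le> 1 / (real (n + 1) * c) * sqnorm (opH \<theta> t \<phi> N1 N2 Q) (u 0 - us))"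
proof -
  let ?D = "opD \<phi> N1 N2 Q" and ?H = "opH \<theta> t \<phi> N1 N2 Q" and ?N = "opN \<theta> t \<phi> N1 N2 Q"
    and ?M = "opM \<phi> N1 N2 Q" and ?G = "opG \<theta> t \<phi> N1 N2 Q" and ?P = "opP f g \<phi>"
  have sa: "self_adjoint N1" "self_adjoint N2" "self_adjoint Q" and bij: "bij N1" "bij N2"
    and \<mu>0: "0 < \<mu>" and Mmono: "strongly_monotone \<mu> ?M" and Mlip: "q-lipschitz_on UNIV ?M"
    using B by (auto simp: assumption_B_def)
  have q0: "0 \<le> q" using Mlip by (rule lipschitz_on_nonneg)
  have Mdiff: "norm (?M x - ?M y) \<le> q * norm (x - y)" for x y
    using lipschitz_onD[OF Mlip] by (simp add: dist_norm)
  have L0: "0 \<le> L" by (simp add: L const_L_def)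
  show ?thesis
  proof (cases "q = 0")
    \<comment> \<open>A constant strongly monotone map forces the space to be trivial. This case is separated
      because it admits \<open>t = 0\<close>.\<close>
    case True
    have trivial: "x = 0" for x :: "'a \<times> 'a"
    proof -
      have "?M x - ?M 0 = 0" using Mdiff[of x 0] True by simp
      moreover have "\<mu> * (norm (x - 0))\<^sup>2 \<le> (?M x - ?M 0) \<bullet> (x - 0)"
        using Mmono unfolding strongly_monotone_def by blast
      ultimately have "\<mu> * (norm x)\<^sup>2 \<le> 0" by simp
      then show ?thesis using \<mu>0 by (simp add: mult_le_0_iff)
    qed
    have "x = y" for x y :: "'a \<times> 'a"
      using trivial[of x] trivial[of y] by simp
    moreover have "sqnorm ?H x = 0" for x
      using trivial[of x] by (simp add: sqnorm_def)
    ultimately show ?thesis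
      by (intro exI[of _ 1]) auto
  next
    case False
    with q0 have qpos: "0 < q" by simp
    have "0 < (\<mu> - \<gamma> - L / 4) / (L + q)" using \<mu>_quarter L0 qpos by simp
    with t \<theta> have \<theta>t: "0 < \<theta> * t" by simp
    have Dsa: "self_adjoint ?D" using D by (simp add: pos_definite_def)
    note Hsa = self_adjoint_opH[OF Dsa, of \<theta> t]
    have HN: "?H (?N w) = ?M w" for w
      by (rule opH_opN[OF bij Dsa less_imp_neq[OF \<theta>t, symmetric]])
    have H0: "0 \<le> sqnorm ?H w" for w
    proof -
      obtain \<beta> where "\<beta> > 0" "\<beta> * (norm w)\<^sup>2 \<le> w \<bullet> ?D w"
        using D unfolding pos_definite_def by blast
      then have "0 \<le> w \<bullet> ?D w" by (smt (verit) mult_nonneg_nonneg zero_le_power2)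
      then show ?thesis using \<theta>t by (simp add: sqnorm_def opH_def)
    qed
    have Nlin: "linear ?N"
      using linear_compose_scale_right[OF linear_opC[OF sa[THEN self_adjoint_linear], of \<phi>], of "\<theta> * t"]
      by (simp add: opN_def[abs_def])
    have Mlin: "linear ?M"
      using linear_compose[OF Nlin self_adjoint_linear[OF Hsa]] HN by (simp add: o_def)
    note Gform = sqnorm_opG[OF sa bij Dsa, of \<theta> t]
    obtain \<alpha> where \<alpha>: "\<alpha> > 0" and G\<alpha>: "\<And>w. \<alpha> * (norm w)\<^sup>2 \<le> sqnorm ?G w"
      using G unfolding pos_definite_def sqnorm_def by blast
    have G0: "0 \<le> sqnorm ?G w" for w
      using G\<alpha>[of w] \<alpha> by (smt (verit) mult_nonneg_nonneg zero_le_power2)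
    define c where "c = \<alpha> / (2 * q)"
    have c0: "c > 0" using \<alpha> qpos by (simp add: c_def)
    have NG: "c * sqnorm ?H (?N w) \<le> sqnorm ?G w" for w
    proof -
      \<comment> \<open>Since \<open>\<parallel>w\<parallel>\<^sub>G\<^sup>2 \<ge> 0\<close>, the bound on \<open>\<parallel>N w\<parallel>\<^sub>H\<^sup>2\<close> reduces to that on \<open>2\<langle>w, M w\<rangle>\<close>, which
        explains the constant \<open>2 q\<close>.\<close>
      have "w \<bullet> ?M w \<le> norm w * norm (?M w)"
        by (rule norm_cauchy_schwarz)
      also have "\<dots> \<le> norm w * (q * norm w)"
        using Mdiff[of w 0] linear_0[OF Mlin] by (intro mult_left_mono) auto
      finally have "sqnorm ?H (?N w) \<le> 2 * q * (norm w)\<^sup>2"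
        using G0[of w] Gform[of w] by (simp add: power2_eq_square algebra_simps)
      then have "c * sqnorm ?H (?N w) \<le> c * (2 * q * (norm w)\<^sup>2)"
        using c0 by simp
      also have "\<dots> = \<alpha> * (norm w)\<^sup>2" using qpos by (simp add: c_def)
      finally show ?thesis using G\<alpha>[of w] by simp
    qed
    show ?thesis
    proof (intro exI[of _ c] conjI allI impI c0)
      fix u r us n
      assume "algorithm1 f g \<phi> N1 N2 Q \<theta> t u r \<and> us \<in> zer ?P"
      then have us: "0 \<in> ?P us"
        and res: "\<And>k. r k \<in> set_inverse (op_sum ?M ?P) (?M (u k))"
        and upd: "\<And>k. u (Suc k) = u k - ?N (u k - r k)"
        by (auto simp: algorithm1_def zer_def opN_def)
      have inP: "?H (?N (u k - r k)) \<in> ?P (r k)" for k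
      proof -
        obtain p where "p \<in> ?P (r k)" "?M (u k) = ?M (r k) + p"
          using res[of k] by (auto simp: set_inverse_def op_sum_def)
        then show ?thesis
          by (simp add: HN linear_diff[OF Mlin])
      qed
      define d where "d k = (u (Suc k) - r (Suc k)) - (u k - r k)" for k
      have dec: "sqnorm ?H (?N (u (Suc k) - r (Suc k)))
          \<le> sqnorm ?H (?N (u k - r k)) - sqnorm ?G (d k)" for k
        using residual_step[where H = ?H and N = ?N, OF mono Hsa Nlin inP[of k] inP[of "Suc k"] upd d_def]
        by (simp add: HN Gform)
      have fejer: "sqnorm ?H (u (Suc k) - us)
          \<le> sqnorm ?H (u k - us) - c * sqnorm ?H (?N (u k - r k))" for k
        using fejer_step[where H = ?H and N = ?N, OF mono Hsa inP[of k] us] NG[of "u k - r k"]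
        by (simp add: HN Gform upd[of k])
      show "sqnorm ?H (?N (u (n + 1) - r (n + 1))) < sqnorm ?H (?N (u n - r n))"
        if ne: "u (n + 1) - r (n + 1) \<noteq> u n - r n"
      proof -
        have "0 < \<alpha> * (norm (d n))\<^sup>2"
          using ne \<alpha> by (simp add: d_def)
        then show ?thesis using dec[of n] G\<alpha>[of "d n"] by simp
      qed
      have "sqnorm ?H (?N (u (Suc k) - r (Suc k))) \<le> sqnorm ?H (?N (u k - r k))" for k
        using dec[of k] G0[of "d k"] by simp
      from decseq_rate[where a = "\<lambda>k. sqnorm ?H (?N (u k - r k))" and e = "\<lambda>k. sqnorm ?H (u k - us)",
          OF c0 this fejer H0]
      show "sqnorm ?H (?N (u n - r n)) \<le> 1 / (real (n + 1) * c) * sqnorm ?H (u 0 - us)" .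
    qed
  qed
qed

end
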